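(* Let $\mathcal{C}$ be the class of graphic matroids. There is no matroid $\mathbf{BigM}$ that is graphic and into which $\mathcal{C}$ admits an online matroid embedding.
   Context: A matroid is graphic if it is isomorphic to the cycle matroid of an undirected graph (ground set the edges, a set of edges independent iff it contains no cycle). A morphism $f:\mathbf{M}\to\mathbf{N}$ is a map of ground sets with $\mathrm{rank}_{\mathbf{N}}(f(S))=\mathrm{rank}_{\mathbf{M}}(S)$ for all $S$; an embedding is an injective morphism. An ordering of $\mathbf{M}$ with $|\mathbf{M}|=m$ is a bijection $\pi:[m]\to\mathbf{M}$; for $m'<m$ the prefix-restriction $(\mathbf{M}',\pi')$ is the restriction of $\mathbf{M}$ to $\pi([m'])$ with $\pi'=\pi|_{[m']}$. An online matroid embedding of $\mathcal{C}$ into $\mathbf{BigM}$ is a family of injective morphisms $f_{\mathbf{M},\pi}:\mathbf{M}\to\mathbf{BigM}$ for all $\mathbf{M}\in\mathcal{C}$ and all orderings $\pi$, such that for every prefix-restriction $(\mathbf{M}',\pi')$ of $(\mathbf{M},\pi)$, $f_{\mathbf{M}',\pi'}$ is the restriction of $f_{\mathbf{M},\pi}$ to $\mathbf{M}'$. *)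

theory Defs
  imports Main "HOL-Library.FuncSet" "HOL-Library.Extended_Nat" "HOL-Library.Infinite_Typeclass"
begin

record 'a matroid =
  ground :: "'a set"
  indep :: "'a set \<Rightarrow> bool"

text \<open>
  The ground set may be infinite. In that case a matroid is understood to be finitary: a set all of
  whose finite subsets are independent is independent. On a finite ground set the last axiom is
  vacuous and the others are the usual ones. Independent sets are required to lie in the ground
  set, so that equality of records is equality of matroids.
\<close>

definition matroid :: "'a matroid \<Rightarrow> bool" where
  "matroid M \<longleftrightarrow>
     (\<forall>X. indep M X \<longrightarrow> X \<subseteq> ground M) \<and>
     indep M {} \<and>
     (\<forall>X Y. indep M X \<and> Y \<subseteq> X \<longrightarrow> indep M Y) \<and>
     (\<forall>X Y. finite X \<and> finite Y \<and> indep M X \<and> indep M Y \<and> card X < card Y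
        \<longrightarrow> (\<exists>y\<in>Y - X. indep M (insert y X))) \<and>
     (\<forall>X\<subseteq>ground M. (\<forall>Y\<subseteq>X. finite Y \<longrightarrow> indep M Y) \<longrightarrow> indep M X)"

text \<open>Sets with independent subsets of unbounded size have rank \<open>\<infinity>\<close>.\<close>

definition rank_of :: "'a matroid \<Rightarrow> 'a set \<Rightarrow> enat" where
  "rank_of M S = (SUP X\<in>{X. X \<subseteq> S \<and> finite X \<and> indep M X}. enat (card X))"

definition morphism :: "('a \<Rightarrow> 'b) \<Rightarrow> 'a matroid \<Rightarrow> 'b matroid \<Rightarrow> bool" where
  "morphism f M N \<longleftrightarrow>
     f ` ground M \<subseteq> ground N \<and> (\<forall>S\<subseteq>ground M. rank_of N (f ` S) = rank_of M S)"

definition embedding :: "('a \<Rightarrow> 'b) \<Rightarrow> 'a matroid \<Rightarrow> 'b matroid \<Rightarrow> bool" where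
  "embedding f M N \<longleftrightarrow> morphism f M N \<and> inj_on f (ground M)"

definition isomorphic :: "'a matroid \<Rightarrow> 'b matroid \<Rightarrow> bool" where
  "isomorphic M N \<longleftrightarrow>
     (\<exists>\<phi>. bij_betw \<phi> (ground M) (ground N) \<and>
          (\<forall>X\<subseteq>ground M. indep M X \<longleftrightarrow> indep N (\<phi> ` X)))"

definition restriction :: "'a matroid \<Rightarrow> 'a set \<Rightarrow> 'a matroid" where
  "restriction M S = \<lparr>ground = ground M \<inter> S, indep = (\<lambda>X. X \<subseteq> S \<and> indep M X)\<rparr>"

text \<open>
  Undirected graphs, possibly infinite, with loops (one end) and parallel edges allowed.
\<close>

record ('v, 'e) multigraph =
  verts :: "'v set"
  edges :: "'e set"
  ends :: "'e \<Rightarrow> 'v set"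

definition multigraph :: "('v, 'e) multigraph \<Rightarrow> bool" where
  "multigraph G \<longleftrightarrow>
     (\<forall>e\<in>edges G. ends G e \<subseteq> verts G \<and> (card (ends G e) = 1 \<or> card (ends G e) = 2))"

text \<open>
  The edge \<open>es ! i\<close> joins the \<open>i\<close>-th vertex to the next one, cyclically. A loop is a cycle of
  length one, and two parallel edges form a cycle of length two.
\<close>

definition cycle :: "('v, 'e) multigraph \<Rightarrow> 'e list \<Rightarrow> bool" where
  "cycle G es \<longleftrightarrow>
     es \<noteq> [] \<and> distinct es \<and> set es \<subseteq> edges G \<and>
     (\<exists>vs. length vs = length es \<and> distinct vs \<and> set vs \<subseteq> verts G \<and>
           (\<forall>i<length es. ends G (es ! i) = {vs ! i, vs ! (Suc i mod length es)}))"

definition cycle_matroid :: "('v, 'e) multigraph \<Rightarrow> 'e matroid" where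
  "cycle_matroid G =
     \<lparr>ground = edges G,
      indep = (\<lambda>X. X \<subseteq> edges G \<and> \<not> (\<exists>es. cycle G es \<and> set es \<subseteq> X))\<rparr>"

text \<open>
  The first argument only names the types from which vertices and edges of the graph are drawn.
\<close>

definition graphic :: "('v, 'e) multigraph itself \<Rightarrow> 'a matroid \<Rightarrow> bool" where
  "graphic T M \<longleftrightarrow>
     matroid M \<and> (\<exists>G :: ('v, 'e) multigraph. multigraph G \<and> isomorphic M (cycle_matroid G))"

text \<open>
  Orderings are extensional, so that they carry no information outside \<open>{1..m}\<close>.
  Only matroids with a finite ground set have an ordering.
\<close>

definition ordering :: "'a matroid \<Rightarrow> (nat \<Rightarrow> 'a) \<Rightarrow> bool" where
  "ordering M \<pi> \<longleftrightarrow>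
     \<pi> \<in> extensional {1..card (ground M)} \<and> bij_betw \<pi> {1..card (ground M)} (ground M)"

definition prefix_restriction ::
  "'a matroid \<Rightarrow> (nat \<Rightarrow> 'a) \<Rightarrow> 'a matroid \<Rightarrow> (nat \<Rightarrow> 'a) \<Rightarrow> bool" where
  "prefix_restriction M' \<pi>' M \<pi> \<longleftrightarrow>
     (\<exists>m'<card (ground M). M' = restriction M (\<pi> ` {1..m'}) \<and> \<pi>' = restrict \<pi> {1..m'})"

definition online_matroid_embedding ::
  "('a matroid \<Rightarrow> (nat \<Rightarrow> 'a) \<Rightarrow> 'a \<Rightarrow> 'b) \<Rightarrow> 'a matroid set \<Rightarrow> 'b matroid \<Rightarrow> bool" where
  "online_matroid_embedding f \<C> BigM \<longleftrightarrow>
     (\<forall>M\<in>\<C>. \<forall>\<pi>. ordering M \<pi> \<longrightarrow>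
        embedding (f M \<pi>) M BigM \<and>
        (\<forall>M'\<in>\<C>. \<forall>\<pi>'. prefix_restriction M' \<pi>' M \<pi> \<longrightarrow>
           (\<forall>x\<in>ground M'. f M' \<pi>' x = f M \<pi> x)))"

end

theory Submission imports Defs "HOL-Combinatorics.Transposition"
begin

text \<open>
  Reveal three independent elements first. Online, they are mapped to three edges of the graph
  behind \<open>BigM\<close> before the fourth element is known, and that element may close a circuit with any
  two of them or with all three. In the first case two of the edges lie on a triangle, so any two of
  the three edges share a vertex. In the second case the three edges lie on a 4-cycle, so two of
  them are opposite and hence disjoint.
\<close>

section \<open>Circuits and their images under embeddings\<close>

definition circuit :: "'a matroid \<Rightarrow> 'a set \<Rightarrow> bool" where
  "circuit M C \<longleftrightarrow> C \<subseteq> ground M \<and> \<not> indep M C \<and> (\<forall>Y. Y \<subset> C \<longrightarrow> indep M Y)"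

text \<open>Morphisms are defined by rank; this turns the rank condition into one on independence.
  In a dependent finite \<open>X\<close> every independent subset is proper, so the rank is at most
  \<open>card X - 1\<close>.\<close>

lemma indep_iff_rank_of:
  assumes "matroid M" "finite X"
  shows "indep M X \<longleftrightarrow> rank_of M X = enat (card X)"
proof
  assume "indep M X"
  then have "enat (card X) \<le> rank_of M X"
    unfolding rank_of_def by (intro SUP_upper) (use assms in auto)
  moreover have "rank_of M X \<le> enat (card X)"
    unfolding rank_of_def by (intro SUP_least) (use assms card_mono in auto)
  ultimately show "rank_of M X = enat (card X)" by simp
next
  assume rank: "rank_of M X = enat (card X)"
  show "indep M X"
  proof (rule ccontr)
    assume dep: "\<not> indep M X"
    moreover have "indep M {}" using assms(1) by (simp add: matroid_def)
    ultimately have "X \<noteq> {}" by auto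
    have "rank_of M X \<le> enat (card X - 1)"
      unfolding rank_of_def
    proof (rule SUP_least)
      fix Y assume "Y \<in> {Y. Y \<subseteq> X \<and> finite Y \<and> indep M Y}"
      then have "Y \<subset> X" using dep by auto
      then have "card Y < card X" using assms(2) by (rule psubset_card_mono[rotated])
      then show "enat (card Y) \<le> enat (card X - 1)" by simp
    qed
    moreover have "card X > 0" using \<open>X \<noteq> {}\<close> assms(2) by (simp add: card_gt_0_iff)
    ultimately show False using rank by simp
  qed
qed

lemma embedding_indep_iff:
  assumes "matroid M" "matroid N" "embedding f M N" "X \<subseteq> ground M" "finite X"
  shows "indep N (f ` X) \<longleftrightarrow> indep M X"
proof -
  have "inj_on f X" using assms(3,4) unfolding embedding_def by (meson inj_on_subset)
  moreover have "rank_of N (f ` X) = rank_of M X"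
    using assms(3,4) unfolding embedding_def morphism_def by auto
  ultimately show ?thesis
    using assms by (simp add: indep_iff_rank_of card_image)
qed

text \<open>Independence is compared only on subsets of \<open>C\<close>, so that this serves both
  for embeddings and for the isomorphism onto a cycle matroid.\<close>

lemma circuit_image:
  assumes "circuit M C"
    and "f ` ground M \<subseteq> ground N"
    and "\<And>X. X \<subseteq> C \<Longrightarrow> indep N (f ` X) \<longleftrightarrow> indep M X"
  shows "circuit N (f ` C)"
proof -
  have C: "C \<subseteq> ground M" using assms(1) unfolding circuit_def by auto
  have "indep N Y" if Y: "Y \<subset> f ` C" for Y
  proof -
    obtain X where X: "X \<subseteq> C" "Y = f ` X" using Y by (meson psubset_imp_subset subset_imageE)
    then have "X \<subset> C" using Y by auto
    then have "indep M X" using assms(1) unfolding circuit_def by simp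
    then show ?thesis using assms(3)[OF X(1)] X(2) by simp
  qed
  moreover have "\<not> indep N (f ` C)"
    using assms(1) assms(3)[OF subset_refl] unfolding circuit_def by simp
  moreover have "f ` C \<subseteq> ground N" using C assms(2) by blast
  ultimately show ?thesis unfolding circuit_def by simp
qed

lemma embedding_circuit:
  assumes "matroid M" "matroid N" "embedding f M N" "circuit M C" "finite C"
  shows "circuit N (f ` C)"
proof (rule circuit_image[OF assms(4)])
  fix X assume "X \<subseteq> C"
  then show "indep N (f ` X) \<longleftrightarrow> indep M X"
    using assms by (intro embedding_indep_iff) (auto simp: circuit_def intro: finite_subset)
qed (use assms(3) in \<open>auto simp: embedding_def morphism_def\<close>)

section \<open>Cycles of a graph and which of their edges meet\<close>

lemma circuit_cycle_matroidD:
  assumes "circuit (cycle_matroid G) C"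
  obtains es where "cycle G es" "set es = C"
proof -
  obtain es where es: "cycle G es" "set es \<subseteq> C"
    using assms unfolding circuit_def cycle_matroid_def by auto
  then have "\<not> indep (cycle_matroid G) (set es)" unfolding cycle_matroid_def by auto
  then have "set es = C" using assms es(2) unfolding circuit_def by auto
  then show thesis using that es by blast
qed

text \<open>Each vertex of a cycle lies on two consecutive edges. They differ unless the cycle is a
  loop, which the condition on \<open>card (ends G e)\<close> excludes.\<close>

lemma cycle_other_edge:
  assumes "cycle G es" "e \<in> set es" "v \<in> ends G e" "card (ends G e) \<noteq> 1"
  obtains e' where "e' \<in> set es" "e' \<noteq> e" "v \<in> ends G e'"
proof -
  let ?n = "length es"
  obtain vs where vs: "length vs = ?n"
      "\<And>i. i < ?n \<Longrightarrow> ends G (es ! i) = {vs ! i, vs ! (Suc i mod ?n)}"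
    and dist: "distinct es"
    using assms(1) unfolding cycle_def by blast
  obtain i where i: "i < ?n" "e = es ! i" using assms(2) by (auto simp: in_set_conv_nth)
  have "?n \<noteq> 1" using assms(4) vs i by auto
  then have n: "?n \<ge> 2" using i by linarith
  \<comment> \<open>The cyclic predecessor of edge \<open>i\<close> also contains
    \<open>vs ! i\<close>, the successor the other end. The case \<open>i = 0\<close> is separate
    because subtraction on naturals truncates.\<close>
  define j where "j = (if v = vs ! i then (if i = 0 then ?n - 1 else i - 1) else Suc i mod ?n)"
  have "Suc i mod ?n < ?n" using n by (intro mod_less_divisor) linarith
  then have "j < ?n" using i n unfolding j_def by auto
  have "j \<noteq> i" using i n unfolding j_def by (auto simp: mod_Suc)
  have "v \<in> ends G (es ! j)"
    using assms(3) i n vs \<open>j < ?n\<close> unfolding j_def by (auto split: if_splits)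
  moreover have "es ! j \<noteq> e" using dist i \<open>j < ?n\<close> \<open>j \<noteq> i\<close> by (simp add: nth_eq_iff_index_eq)
  ultimately show thesis using that[of "es ! j"] \<open>j < ?n\<close> by simp
qed

text \<open>Any two distinct edges of a triangle are cyclically consecutive.\<close>

lemma cycle_length_3_adjacent:
  assumes "cycle G es" "length es = 3" "e \<in> set es" "e' \<in> set es"
  shows "ends G e \<inter> ends G e' \<noteq> {}"
proof -
  obtain vs where vs: "\<forall>i<3. ends G (es ! i) = {vs ! i, vs ! (Suc i mod 3)}"
    using assms(1,2) unfolding cycle_def by auto
  have *: "ends G (es ! 0) = {vs ! 0, vs ! 1}" "ends G (es ! 1) = {vs ! 1, vs ! 2}"
      "ends G (es ! 2) = {vs ! 2, vs ! 0}"
    using vs[rule_format, of 0] vs[rule_format, of 1] vs[rule_format, of 2]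
    by (simp_all add: numeral_2_eq_2[symmetric])
  have "set es = {es ! 0, es ! 1, es ! 2}"
    using assms(2) by (auto simp: set_conv_nth numeral_3_eq_3 less_Suc_eq numeral_2_eq_2)
  then show ?thesis using assms(3,4) * by auto
qed

text \<open>Opposite edges are disjoint since the vertices are distinct, and one of the two opposite
  pairs avoids \<open>w\<close>.\<close>

lemma cycle_length_4_disjoint:
  assumes "cycle G es" "set es = {x, y, z, w}" "length es = 4"
  obtains e e' where "e \<in> {x, y, z}" "e' \<in> {x, y, z}" "e \<noteq> e'" "ends G e \<inter> ends G e' = {}"
proof -
  obtain vs where vs: "\<forall>i<4. ends G (es ! i) = {vs ! i, vs ! (Suc i mod 4)}"
      "length vs = 4" "distinct vs"
    using assms(1,3) unfolding cycle_def by auto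
  have dist: "distinct es" using assms(1) unfolding cycle_def by auto
  have ends: "ends G (es ! 0) = {vs ! 0, vs ! 1}" "ends G (es ! 1) = {vs ! 1, vs ! 2}"
      "ends G (es ! 2) = {vs ! 2, vs ! 3}" "ends G (es ! 3) = {vs ! 3, vs ! 0}"
    using vs(1)[rule_format, of 0] vs(1)[rule_format, of 1] vs(1)[rule_format, of 2]
      vs(1)[rule_format, of 3]
    by (simp_all add: numeral_2_eq_2[symmetric])
  have nth: "es ! 0 \<in> set es" "es ! 1 \<in> set es" "es ! 2 \<in> set es" "es ! 3 \<in> set es"
    using assms(3) by auto
  have ne: "es ! 0 \<noteq> es ! 2" "es ! 1 \<noteq> es ! 3"
      "{es ! 0, es ! 2} \<inter> {es ! 1, es ! 3} = {}"
    using dist assms(3) by (auto simp: nth_eq_iff_index_eq)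
  have disj: "ends G (es ! 0) \<inter> ends G (es ! 2) = {}" "ends G (es ! 1) \<inter> ends G (es ! 3) = {}"
    unfolding ends using vs(2,3) by (auto simp: nth_eq_iff_index_eq)
  show thesis
  proof (cases "w \<in> {es ! 0, es ! 2}")
    case True
    then have "es ! 1 \<noteq> w" "es ! 3 \<noteq> w" using ne(3) by auto
    then show thesis using that[of "es ! 1" "es ! 3"] nth ne disj assms(2) by blast
  next
    case False
    then show thesis using that[of "es ! 0" "es ! 2"] nth ne disj assms(2) by blast
  qed
qed

section \<open>Matroids with at most one circuit, and their graphs\<close>

text \<open>
  \<open>C\<close> is the only circuit. If \<open>C\<close> is not contained in \<open>E\<close>, every subset of \<open>E\<close> is independent.
\<close>

definition single_circuit :: "'a set \<Rightarrow> 'a set \<Rightarrow> 'a matroid" where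
  "single_circuit E C = \<lparr>ground = E, indep = (\<lambda>X. X \<subseteq> E \<and> \<not> C \<subseteq> X)\<rparr>"

lemma ground_single_circuit [simp]: "ground (single_circuit E C) = E"
  by (simp add: single_circuit_def)

lemma indep_single_circuit [simp]: "indep (single_circuit E C) X \<longleftrightarrow> X \<subseteq> E \<and> \<not> C \<subseteq> X"
  by (simp add: single_circuit_def)

lemma circuit_single_circuit: "C \<subseteq> E \<Longrightarrow> circuit (single_circuit E C) C"
  unfolding circuit_def by auto

lemma restriction_single_circuit:
  "E' \<subseteq> E \<Longrightarrow> restriction (single_circuit E C) E' = single_circuit E' C"
  unfolding restriction_def single_circuit_def by (auto simp: fun_eq_iff)

text \<open>This is what hides the future: prefixes of matroids with different circuits are equal as
  records, so an online embedding must treat them alike.\<close>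

lemma single_circuit_free:
  assumes "\<not> C \<subseteq> E" "\<not> D \<subseteq> E"
  shows "single_circuit E C = single_circuit E D"
  using assms unfolding single_circuit_def by (auto simp: fun_eq_iff)

text \<open>\<open>C \<noteq> {}\<close> makes the empty set independent, and finiteness of
  \<open>C\<close> gives the finitary axiom, \<open>C\<close> itself being a finite dependent subset
  of any set that contains it.\<close>

lemma matroid_single_circuit:
  assumes "finite C" "C \<noteq> {}"
  shows "matroid (single_circuit E C)"
  unfolding matroid_def indep_single_circuit ground_single_circuit
proof (intro conjI allI impI)
  fix X Y
  assume *: "finite X \<and> finite Y \<and> (X \<subseteq> E \<and> \<not> C \<subseteq> X) \<and> (Y \<subseteq> E \<and> \<not> C \<subseteq> Y) \<and> card X < card Y"
  show "\<exists>y\<in>Y - X. insert y X \<subseteq> E \<and> \<not> C \<subseteq> insert y X"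
  proof (rule ccontr)
    assume "\<not> ?thesis"
    then have sub: "C \<subseteq> insert y X" if "y \<in> Y - X" for y using that * by blast
    have "\<not> Y \<subseteq> X" using * card_mono[of X Y] by auto
    then obtain y where y: "y \<in> Y - X" by auto
    \<comment> \<open>Two different elements of \<open>Y - X\<close> would force \<open>C\<close>
      into the intersection of the two extended sets, which is \<open>X\<close>.\<close>
    then have "Y - X = {y}" using sub * by blast
    then have "Y = insert y (Y \<inter> X)" by auto
    then have "card Y = Suc (card (Y \<inter> X))"
      using y * by (metis DiffD2 IntD2 card_insert_disjoint finite_Int)
    then have "Y \<inter> X = X" using * by (intro card_subset_eq) (auto intro: le_antisym card_mono)
    then have "C \<subseteq> Y" using sub[OF y] y by auto
    then show False using * by auto
  qed
qed (use assms in auto)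

text \<open>
  The graph has edges \<open>0, \<dots>, n - 1\<close>, where \<open>i\<close> joins vertex \<open>i\<close> to vertex \<open>i + 1\<close>, except that the
  edge \<open>k - 1\<close> returns to vertex \<open>0\<close>. If \<open>k > n\<close> this is just a path.
\<close>

lemma graphic_single_circuit:
  fixes a :: "nat \<Rightarrow> 'a"
  assumes a: "inj a" and k: "k \<ge> 2"
  shows "graphic TYPE(('v::infinite, 'e::infinite) multigraph)
           (single_circuit (a ` {..<n}) (a ` {..<k}))"
proof -
  obtain v :: "nat \<Rightarrow> 'v" where v: "inj v"
    using infinite_countable_subset[OF infinite_UNIV] by blast
  obtain b :: "nat \<Rightarrow> 'e" where b: "inj b"
    using infinite_countable_subset[OF infinite_UNIV] by blast
  define succ where "succ i = (if Suc i = k then 0 else Suc i)" for i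
  define G :: "('v, 'e) multigraph" where
    "G = \<lparr>verts = UNIV, edges = b ` {..<n}, ends = (\<lambda>e. {v (inv b e), v (succ (inv b e))})\<rparr>"
  have edges: "edges G = b ` {..<n}" and verts: "verts G = UNIV"
    and ends: "ends G (b i) = {v i, v (succ i)}" for i
    using b by (auto simp: G_def)
  have succ_neq: "succ i \<noteq> i" for i using k unfolding succ_def by auto
  have card_ends: "card (ends G (b i)) = 2" for i
    using succ_neq[of i] v by (auto simp: ends inj_eq card_insert_if)
  have G: "multigraph G"
    unfolding multigraph_def by (auto simp: edges verts card_ends)

  \<comment> \<open>No edge of a cycle may have an end that meets no other edge of it. Applied to
    the largest index this forces \<open>k - 1\<close> into the cycle, and descending from there
    forces all smaller indices.\<close>
  have cycle_set: "b ` {..<k} \<subseteq> set es" if "cycle G es" for es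
  proof -
    define I where "I = {i. b i \<in> set es}"
    have es: "set es = b ` I" "I \<subseteq> {..<n}" "I \<noteq> {}"
    proof -
      have "es \<noteq> []" "set es \<subseteq> b ` {..<n}" using that unfolding cycle_def edges by auto
      then show "set es = b ` I" "I \<subseteq> {..<n}" "I \<noteq> {}"
        using b unfolding I_def by (fastforce simp: inj_eq neq_Nil_conv)+
    qed
    then have fin: "finite I" by (auto intro: finite_subset)
    have other: "\<exists>j\<in>I. j \<noteq> i \<and> (u = j \<or> u = succ j)" if iu: "i \<in> I" "u = i \<or> u = succ i" for i u
    proof -
      obtain e where "e \<in> set es" "e \<noteq> b i" "v u \<in> ends G e"
        by (rule cycle_other_edge[OF \<open>cycle G es\<close>, of "b i" "v u"])
          (use iu es ends[of i] card_ends[of i] in auto)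
      then show ?thesis using v es by (auto simp: ends inj_eq)
    qed
    \<comment> \<open>Otherwise the far end of the last edge is vertex \<open>Suc (Max I)\<close>,
      which only an edge of larger index could meet.\<close>
    have max: "Suc (Max I) = k"
    proof (rule ccontr)
      assume neq: "Suc (Max I) \<noteq> k"
      have "Max I \<in> I" using fin es by simp
      then obtain j where j: "j \<in> I" "j \<noteq> Max I" "Suc (Max I) = j \<or> Suc (Max I) = succ j"
        using other[of "Max I" "Suc (Max I)"] neq unfolding succ_def by auto
      have "j \<le> Max I" using j fin by simp
      then show False using j neq unfolding succ_def by (auto split: if_splits)
    qed
    then have "k - 1 \<in> I" using fin es(3) by (metis Max_in diff_Suc_1)
    \<comment> \<open>Besides edge \<open>Suc i\<close>, only edge \<open>i\<close> can meet vertex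
      \<open>Suc i\<close>.\<close>
    have pred: "i \<in> I" if "Suc i \<in> I" "Suc i < k" for i
    proof -
      obtain j where "j \<in> I" "j \<noteq> Suc i" "Suc i = j \<or> Suc i = succ j"
        using other[of "Suc i" "Suc i"] \<open>Suc i \<in> I\<close> by auto
      then show ?thesis unfolding succ_def by (auto split: if_splits)
    qed
    have "i \<in> I" if "i \<le> k - 1" for i
      using that
    proof (induction rule: inc_induct)
      case base
      show ?case by fact
    next
      case (step i)
      then show ?case using pred[of i] by auto
    qed
    then show ?thesis using es by auto
  qed

  have cycle_ex: "\<exists>es. cycle G es \<and> set es = b ` {..<k}" if "k \<le> n"
  proof (intro exI conjI)
    show "set (map b [0..<k]) = b ` {..<k}" by auto
    show "cycle G (map b [0..<k])"
      unfolding cycle_def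
    proof (intro conjI exI[of _ "map v [0..<k]"])
      show "\<forall>i<length (map b [0..<k]). ends G (map b [0..<k] ! i) =
          {map v [0..<k] ! i, map v [0..<k] ! (Suc i mod length (map b [0..<k]))}"
        using k by (auto simp: ends succ_def mod_Suc)
      show "distinct (map b [0..<k])" "distinct (map v [0..<k])"
        using b v by (simp_all add: distinct_map inj_on_def)
    qed (use k that in \<open>auto simp: verts edges\<close>)
  qed

  have indep: "indep (cycle_matroid G) Y \<longleftrightarrow> Y \<subseteq> b ` {..<n} \<and> \<not> b ` {..<k} \<subseteq> Y" for Y
  proof (cases "b ` {..<k} \<subseteq> Y \<and> Y \<subseteq> b ` {..<n}")
    case True
    then have "{..<k} \<subseteq> {..<n}" using b by (meson inj_image_subset_iff order_trans)
    then have "k \<le> n" by auto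
    then obtain es where "cycle G es" "set es \<subseteq> Y" using cycle_ex True by auto
    then have "\<not> indep (cycle_matroid G) Y" unfolding cycle_matroid_def by auto
    then show ?thesis using True by simp
  next
    case False
    then show ?thesis using cycle_set by (auto simp: cycle_matroid_def edges)
  qed

  have "isomorphic (single_circuit (a ` {..<n}) (a ` {..<k})) (cycle_matroid G)"
    unfolding isomorphic_def
  \<comment> \<open>This map sends \<open>a i\<close> to \<open>b i\<close>.\<close>
  proof (intro exI[of _ "b \<circ> inv a"] conjI allI impI)
    show "bij_betw (b \<circ> inv a) (ground (single_circuit (a ` {..<n}) (a ` {..<k})))
        (ground (cycle_matroid G))"
    proof (rule bij_betw_imageI)
      show "inj_on (b \<circ> inv a) (ground (single_circuit (a ` {..<n}) (a ` {..<k})))"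
        using a b by (auto intro!: inj_onI dest: injD[OF b])
      show "(b \<circ> inv a) ` ground (single_circuit (a ` {..<n}) (a ` {..<k})) =
          ground (cycle_matroid G)"
        using a by (simp add: cycle_matroid_def edges image_image)
    qed
  next
    fix X assume "X \<subseteq> ground (single_circuit (a ` {..<n}) (a ` {..<k}))"
    then obtain Z where Z: "X = a ` Z" by (auto simp: subset_image_iff)
    have "(b \<circ> inv a) ` X = b ` Z" using a by (simp only: Z image_comp[symmetric] image_inv_f_f)
    then show "indep (single_circuit (a ` {..<n}) (a ` {..<k})) X
        \<longleftrightarrow> indep (cycle_matroid G) ((b \<circ> inv a) ` X)"
      using a b by (simp add: indep Z inj_image_subset_iff)
  qed
  moreover have "matroid (single_circuit (a ` {..<n}) (a ` {..<k}))"
    using k by (intro matroid_single_circuit) (auto simp: lessThan_empty_iff)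
  ultimately show ?thesis unfolding graphic_def using G by blast
qed

section \<open>Forcing contradictory positions on three edges\<close>

theorem theorem5:
  fixes \<C> :: "'a::infinite matroid set"
  assumes "\<C> = {M. graphic TYPE(('v::infinite, 'e::infinite) multigraph) M}"
  shows "\<not> (\<exists>BigM :: 'b matroid.
            graphic TYPE(('w, 'd) multigraph) BigM \<and>
            (\<exists>f. online_matroid_embedding f \<C> BigM))"
proof
  assume "\<exists>BigM :: 'b matroid.
            graphic TYPE(('w, 'd) multigraph) BigM \<and>
            (\<exists>f. online_matroid_embedding f \<C> BigM)"
  then obtain BigM :: "'b matroid" and f and H :: "('w, 'd) multigraph" and \<phi>
    where big: "matroid BigM" and f: "online_matroid_embedding f \<C> BigM"
      and \<phi>: "bij_betw \<phi> (ground BigM) (ground (cycle_matroid H))"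
        "\<And>X. X \<subseteq> ground BigM \<Longrightarrow> indep BigM X \<longleftrightarrow> indep (cycle_matroid H) (\<phi> ` X)"
    unfolding graphic_def isomorphic_def by blast
  obtain a :: "nat \<Rightarrow> 'a" where a: "inj a"
    using infinite_countable_subset[OF infinite_UNIV] by blast
  define E where "E = a ` {..<4}"
  \<comment> \<open>Orderings start at 1 and \<open>a\<close> at 0, hence the shift;
    \<open>restrict\<close> makes the ordering extensional.\<close>
  define \<pi> where "\<pi> = restrict (\<lambda>i. a (i - 1)) {1..4}"
  define \<pi>3 where "\<pi>3 = restrict \<pi> {1..3}"
  \<comment> \<open>\<open>E\<close> does not fit into three elements, so every subset of them is
    independent here.\<close>
  define free where "free = single_circuit (a ` {..<3}) E"
  \<comment> \<open>The edge of \<open>H\<close> assigned to the \<open>i\<close>-th element before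
    the fourth one is revealed.\<close>
  define x where "x i = \<phi> (f free \<pi>3 (a i))" for i

  have free: "free \<in> \<C>"
    unfolding free_def E_def assms using graphic_single_circuit[OF a, of 4 3] by simp
  have card_E: "card E = 4" using a unfolding E_def by (simp add: card_image inj_on_subset)
  have shift: "(\<lambda>i. a (i - 1)) ` {1..m} = a ` {..<m}" for m
  proof -
    have "(\<lambda>i. i - 1) ` {1..m} = {..<m}"
      by (auto simp: image_iff intro!: bexI[of _ "Suc _"])
    then show ?thesis by (metis image_image)
  qed
  have \<pi>_image: "\<pi> ` {1..m} = a ` {..<m}" if "m \<le> 4" for m
  proof -
    have "\<pi> ` {1..m} = (\<lambda>i. a (i - 1)) ` {1..m}"
      unfolding \<pi>_def using that by (intro image_cong) auto
    then show ?thesis by (simp only: shift)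
  qed

  \<comment> \<open>Letting the fourth element close a circuit with \<open>S\<close> forces the
    edges already fixed for \<open>S\<close> to form a cycle of \<open>H\<close> with one new edge
    \<open>y\<close>.\<close>
  have main: "\<exists>y es. cycle H es \<and> set es = insert y (x ` S) \<and> length es = Suc (card S)"
    if S: "S \<subseteq> {..<3}" and graphic: "single_circuit E (a ` insert 3 S) \<in> \<C>" for S
  proof -
    let ?C = "a ` insert 3 S"
    let ?M = "single_circuit E ?C"
    have ord: "ordering ?M \<pi>"
      unfolding ordering_def ground_single_circuit card_E
    proof
      show "\<pi> \<in> extensional {1..4}" unfolding \<pi>_def by simp
      have "inj_on \<pi> {1..4}"
      proof (rule inj_onI)
        fix i j assume "i \<in> {1..4}" "j \<in> {1..4}" "\<pi> i = \<pi> j"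
        then show "i = j" using injD[OF a, of "i - 1" "j - 1"] unfolding \<pi>_def by auto
      qed
      then show "bij_betw \<pi> {1..4} E" using \<pi>_image[of 4] by (simp add: bij_betw_def E_def)
    qed
    have "restriction ?M (\<pi> ` {1..3}) = single_circuit (a ` {..<3}) ?C"
      using \<pi>_image[of 3] by (simp add: restriction_single_circuit E_def image_mono)
    \<comment> \<open>Both \<open>?C\<close> and \<open>E\<close> contain \<open>a 3\<close>, which
      is missing from the prefix.\<close>
    also have "\<dots> = free"
      unfolding free_def E_def using a
      by (intro single_circuit_free) (auto simp: inj_image_subset_iff inj_image_mem_iff)
    finally have "prefix_restriction free \<pi>3 ?M \<pi>"
      unfolding prefix_restriction_def \<pi>3_def by (auto simp: card_E intro!: exI[of _ 3])
    then have agree: "f free \<pi>3 (a i) = f ?M \<pi> (a i)" if "i < 3" for i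
      using f graphic ord free that unfolding online_matroid_embedding_def by (auto simp: free_def)
    have emb: "embedding (f ?M \<pi>) ?M BigM"
      using f graphic ord unfolding online_matroid_embedding_def by auto
    have fin: "finite S" using S finite_subset by blast
    have "?C \<subseteq> E" using S unfolding E_def by auto
    then have "circuit BigM (f ?M \<pi> ` ?C)"
      using fin by (intro embedding_circuit[OF _ big emb] circuit_single_circuit matroid_single_circuit) auto
    then have "circuit (cycle_matroid H) (\<phi> ` f ?M \<pi> ` ?C)"
    proof (rule circuit_image)
      show "\<phi> ` ground BigM \<subseteq> ground (cycle_matroid H)" using \<phi>(1) by (simp add: bij_betw_def)
      fix X assume "X \<subseteq> f ?M \<pi> ` ?C"
      then have "X \<subseteq> ground BigM"
        using \<open>circuit BigM (f ?M \<pi> ` ?C)\<close> unfolding circuit_def by (meson order_trans)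
      then show "indep (cycle_matroid H) (\<phi> ` X) \<longleftrightarrow> indep BigM X" using \<phi>(2) by simp
    qed
    then obtain es where es: "cycle H es" "set es = \<phi> ` f ?M \<pi> ` ?C"
      by (rule circuit_cycle_matroidD)
    have "f ?M \<pi> ` a ` S = f free \<pi>3 ` a ` S"
      using agree S by (auto simp: image_iff subset_iff)
    then have "set es = insert (\<phi> (f ?M \<pi> (a 3))) (x ` S)"
      unfolding es x_def by (simp add: image_image)
    \<comment> \<open>Injectivity of the embedding and of \<open>\<phi>\<close> keeps the edges
      distinct, so the cycle has as many edges as the circuit has elements.\<close>
    moreover have "length es = Suc (card S)"
    proof -
      have "inj_on (f ?M \<pi>) E" "f ?M \<pi> ` E \<subseteq> ground BigM"
        using emb unfolding embedding_def morphism_def by auto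
      then have "inj_on (f ?M \<pi>) ?C" "f ?M \<pi> ` ?C \<subseteq> ground BigM"
        using \<open>?C \<subseteq> E\<close> by (blast intro: inj_on_subset)+
      moreover from this have "inj_on \<phi> (f ?M \<pi> ` ?C)"
        using \<phi>(1) unfolding bij_betw_def by (meson inj_on_subset)
      ultimately have "card (set es) = card (insert 3 S)"
        unfolding es using a by (metis card_image inj_on_subset top_greatest)
      also have "\<dots> = Suc (card S)" using S fin by (subst card_insert_disjoint) auto
      finally show ?thesis using es(1) by (simp add: cycle_def distinct_card)
    qed
    ultimately show ?thesis using es(1) by blast
  qed

  have adjacent: "ends H (x i) \<inter> ends H (x j) \<noteq> {}" if ij: "i < 3" "j < 3" "i \<noteq> j" for i j
  proof -
    \<comment> \<open>The third index, as 0 + 1 + 2 = 3. Exchanging it with 3 puts \<open>i\<close>,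
      \<open>j\<close> and 3 on the first three positions, where
      \<open>graphic_single_circuit\<close> places its circuit.\<close>
    define l where "l = 3 - i - j"
    have "(i = 0 \<or> i = 1 \<or> i = 2) \<and> (j = 0 \<or> j = 1 \<or> j = 2)" using ij(1,2) by linarith
    then have l: "{i, j} = {..<3} - {l}" "l < 3" using ij(3) unfolding l_def by auto
    have inj: "inj (a \<circ> transpose l 3)" using a by (simp add: inj_compose)
    have "transpose l 3 ` {..<4} = {..<4}" "transpose l 3 ` {..<3} = insert 3 {i, j}"
      using l(2) unfolding l(1) by (auto simp: transpose_def image_iff)
    then have "single_circuit E (a ` insert 3 {i, j}) \<in> \<C>"
      using graphic_single_circuit[OF inj, of 3 4] unfolding assms E_def
      by (simp only: image_comp[symmetric]) simp
    then obtain y es where "cycle H es" "set es = insert y (x ` {i, j})" "length es = 3"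
      using main[of "{i, j}"] ij by auto
    then show ?thesis by (intro cycle_length_3_adjacent) auto
  qed

  \<comment> \<open>With all three elements in the circuit, the fixed edges lie on a 4-cycle, so two
    of them are disjoint, against \<open>adjacent\<close>.\<close>
  have lt4: "insert 3 {..<3} = {..<4::nat}" by auto
  have "single_circuit E (a ` insert 3 {..<3}) \<in> \<C>"
    unfolding assms E_def lt4 using graphic_single_circuit[OF a, of 4 4] by simp
  then obtain y es where es: "cycle H es" "set es = insert y (x ` {..<3})" "length es = 4"
    using main[of "{..<3}"] by auto
  have x: "x ` {..<3} = {x 0, x 1, x 2}"
    by (auto simp: numeral_3_eq_3 numeral_2_eq_2 lessThan_Suc)
  then have "set es = {x 0, x 1, x 2, y}" using es(2) by auto
  then obtain e e' where e: "e \<in> {x 0, x 1, x 2}" "e' \<in> {x 0, x 1, x 2}" "e \<noteq> e'"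
    "ends H e \<inter> ends H e' = {}"
    using cycle_length_4_disjoint es by metis
  obtain i where i: "i < 3" "e = x i" using e(1) unfolding x[symmetric] by auto
  obtain j where j: "j < 3" "e' = x j" using e(2) unfolding x[symmetric] by auto
  show False using adjacent[of i j] i j e by auto
qed

end
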